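(* Consider a non-autonomous system $\dot x=f(x,t)$, $x\in\mathcal X\subset\mathbb R^n$, $t\ge0$, and let $1\le i\le n$. Assume there exist a metric transformation $\Theta(x,t)$ and a differentiable bounded scalar function $\gamma(t)$ such that, for some $\alpha>0$, $$(\lambda_1+\dots+\lambda_i)+\dot\gamma\le-\alpha\qquad\text{for all }t\ge0\ (\text{and all }x\in\mathcal X),$$ where $\lambda_1\ge\dots\ge\lambda_n$ are the ranked eigenvalues of the Hermitian part of the generalized Jacobian associated with $\Theta(x,t)$. Then any $i$-dimensional volume shrinks exponentially to zero with rate $\alpha$; that is, there is a constant $C>0$ such that for every solution $x(t)\in\mathcal X$, $t\ge0$, and all differential displacements $\delta x_1,\dots,\delta x_i$ along it, with $\delta z_j=\Theta(x(t),t)\,\delta x_j$, $$\|\delta z_1(t)\wedge\dots\wedge\delta z_i(t)\|\le C e^{-\alpha t}\,\|\delta z_1(0)\wedge\dots\wedge\delta z_i(0)\|\qquad\text{for all }t\ge0.$$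
   Context: $f$ is continuously differentiable and $J(x,t)=\partial f/\partial x$ is its Jacobian; $\mathcal X$ is a forward-invariant set on which solutions exist for all $t\ge0$. A metric transformation is a continuously differentiable, (real or complex) nonsingular $n\times n$ matrix-valued function $\Theta(x,t)$ such that the associated Riemannian metric $\Theta(x,t)^{*}\Theta(x,t)$ ($^*$ being conjugate transpose) is uniformly positive definite. The generalized Jacobian associated with $\Theta$ is $$F=\Theta J\Theta^{-1}+\dot\Theta\,\Theta^{-1},$$ where $\dot\Theta=\partial\Theta/\partial t+\sum_k(\partial\Theta/\partial x_k)f_k$ is the derivative along trajectories; its Hermitian part is $\tfrac12(F+F^{*})$. A differential displacement $\delta x(t)$ along a solution $x(t)$ is a solution of the variational equation $\frac{d}{dt}\delta x=J(x(t),t)\,\delta x$. The symbol $\wedge$ is the exterior product and $\|\delta z_1\wedge\dots\wedge\delta z_i\|$ is the $i$-dimensional volume of the parallelepiped spanned by $\delta z_1,\dots,\delta z_i$, i.e. the square root of the determinant of their Gram matrix. "$i$-dimensional volume" refers to this metric-weighted differential volume. *)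

theory Defs
  imports "HOL-Analysis.Analysis" "HOL-Computational_Algebra.Computational_Algebra"
begin

subsection \<open>Complex matrices and their ranked eigenvalues\<close>

definition cvec :: "real ^ 'n \<Rightarrow> complex ^ 'n" where
  "cvec v = (\<chi> k. complex_of_real (v $ k))"

definition conj_transpose :: "complex ^ 'n ^ 'm \<Rightarrow> complex ^ 'm ^ 'n" where
  "conj_transpose A = map_matrix cnj (transpose A)"

definition hermitian_part :: "complex ^ 'n ^ 'n \<Rightarrow> complex ^ 'n ^ 'n" where
  "hermitian_part A = (1/2) *\<^sub>R (A + conj_transpose A)"

definition charpoly :: "complex ^ 'n ^ 'n \<Rightarrow> complex poly" where
  "charpoly A = det (mat [:0, 1:] - map_matrix (\<lambda>a. [:a:]) A)"

text \<open>
  The eigenvalues, repeated according to their multiplicity as roots of the characteristic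
  polynomial and listed in decreasing order. This is meant for Hermitian matrices, whose
  eigenvalues are real, so that taking real parts only changes the type.
\<close>
definition ranked_eigenvalues :: "complex ^ 'n ^ 'n \<Rightarrow> real list" where
  "ranked_eigenvalues A = rev (sorted_list_of_multiset (image_mset Re (proots (charpoly A))))"

text \<open>Numbered from 1: \<open>ranked_eigenvalue A 1\<close> is the largest one.\<close>
definition ranked_eigenvalue :: "complex ^ 'n ^ 'n \<Rightarrow> nat \<Rightarrow> real" where
  "ranked_eigenvalue A k = ranked_eigenvalues A ! (k - 1)"

definition cinner :: "complex ^ 'n \<Rightarrow> complex ^ 'n \<Rightarrow> complex" where
  "cinner u v = (\<Sum>k\<in>UNIV. cnj (u $ k) * v $ k)"

definition gram_matrix :: "('i \<Rightarrow> complex ^ 'n) \<Rightarrow> complex ^ 'i ^ 'i" where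
  "gram_matrix z = (\<chi> j k. cinner (z j) (z k))"

text \<open>
  Volume of the parallelepiped spanned by the family \<open>z\<close>, i.e. the norm of the exterior product
  of its members; its dimension is the cardinality of the index type. The Gram determinant is a
  nonnegative real number, so \<open>Re\<close> only changes the type.
\<close>
definition wedge_norm :: "('i::finite \<Rightarrow> complex ^ 'n) \<Rightarrow> real" where
  "wedge_norm z = sqrt (Re (det (gram_matrix z)))"


subsection \<open>Time-varying systems\<close>

text \<open>
  Derivatives are taken within \<open>S\<close>. Below, \<open>S\<close> is a product of an open set of states with
  \<open>{0..}\<close>: derivatives within such a set are unique, and one-sided in time at time 0.
\<close>
definition C1_on :: "('a::real_normed_vector \<Rightarrow> 'b::real_normed_vector) \<Rightarrow> 'a set \<Rightarrow> bool" where
  "C1_on g S \<longleftrightarrow> (\<exists>g' :: 'a \<Rightarrow> 'a \<Rightarrow>\<^sub>L 'b.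
     (\<forall>p\<in>S. (g has_derivative blinfun_apply (g' p)) (at p within S)) \<and> continuous_on S g')"

text \<open>Solutions, on a time interval \<open>T\<close>, of the system whose right-hand side has state domain \<open>U\<close>.\<close>
definition solution_on ::
    "(real ^ 'n \<Rightarrow> real \<Rightarrow> real ^ 'n) \<Rightarrow> (real ^ 'n) set \<Rightarrow> real set \<Rightarrow> (real \<Rightarrow> real ^ 'n) \<Rightarrow> bool" where
  "solution_on f U T x \<longleftrightarrow>
     (\<forall>t\<in>T. x t \<in> U \<and> (x has_vector_derivative f (x t) t) (at t within T))"

definition forward_invariant ::
    "(real ^ 'n \<Rightarrow> real \<Rightarrow> real ^ 'n) \<Rightarrow> (real ^ 'n) set \<Rightarrow> (real ^ 'n) set \<Rightarrow> bool" where
  "forward_invariant f U X \<longleftrightarrow>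
     (\<forall>t0 t1 x. 0 \<le> t0 \<and> solution_on f U {t0..t1} x \<and> x t0 \<in> X \<longrightarrow> (\<forall>t\<in>{t0..t1}. x t \<in> X))"

definition solutions_exist ::
    "(real ^ 'n \<Rightarrow> real \<Rightarrow> real ^ 'n) \<Rightarrow> (real ^ 'n) set \<Rightarrow> (real ^ 'n) set \<Rightarrow> bool" where
  "solutions_exist f U X \<longleftrightarrow> (\<forall>x0\<in>X. \<exists>x. x 0 = x0 \<and> solution_on f U {0..} x)"

definition state_jacobian ::
    "(real ^ 'n \<Rightarrow> real \<Rightarrow> real ^ 'n) \<Rightarrow> real ^ 'n \<Rightarrow> real \<Rightarrow> real ^ 'n ^ 'n" where
  "state_jacobian f x t = jacobian (\<lambda>y. f y t) (at x)"

definition displacement ::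
    "(real ^ 'n \<Rightarrow> real \<Rightarrow> real ^ 'n) \<Rightarrow> (real \<Rightarrow> real ^ 'n) \<Rightarrow> (real \<Rightarrow> real ^ 'n) \<Rightarrow> bool" where
  "displacement f x \<delta> \<longleftrightarrow>
     (\<forall>t\<ge>0. (\<delta> has_vector_derivative state_jacobian f (x t) t *v \<delta> t) (at t within {0..}))"


subsection \<open>Metric transformations and generalized Jacobians\<close>

text \<open>
  Smoothness is required on an open set \<open>U\<close> of states, so that the partial derivatives make
  sense even if \<open>X\<close> is not open; the metric conditions are required on \<open>X\<close> only. Real
  transformations are those with real entries.
\<close>
definition metric_transformation ::
    "(real ^ 'n) set \<Rightarrow> (real ^ 'n) set \<Rightarrow> (real ^ 'n \<Rightarrow> real \<Rightarrow> complex ^ 'n ^ 'n) \<Rightarrow> bool" where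
  "metric_transformation U X \<Theta> \<longleftrightarrow>
     C1_on (\<lambda>(x, t). \<Theta> x t) (U \<times> {0..}) \<and>
     (\<forall>x\<in>X. \<forall>t\<ge>0. invertible (\<Theta> x t)) \<and>
     (\<exists>\<beta>>0. \<forall>x\<in>X. \<forall>t\<ge>0. \<forall>v.
        Re (cinner v ((conj_transpose (\<Theta> x t) ** \<Theta> x t) *v v)) \<ge> \<beta> * (norm v)\<^sup>2)"

definition trajectory_derivative ::
    "(real ^ 'n \<Rightarrow> real \<Rightarrow> real ^ 'n) \<Rightarrow> (real ^ 'n \<Rightarrow> real \<Rightarrow> complex ^ 'n ^ 'n)
       \<Rightarrow> real ^ 'n \<Rightarrow> real \<Rightarrow> complex ^ 'n ^ 'n" where
  "trajectory_derivative f \<Theta> x t =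
     vector_derivative (\<lambda>s. \<Theta> x s) (at t within {0..}) +
     (\<Sum>k\<in>UNIV. (f x t $ k) *\<^sub>R frechet_derivative (\<lambda>y. \<Theta> y t) (at x) (axis k 1))"

definition generalized_jacobian ::
    "(real ^ 'n \<Rightarrow> real \<Rightarrow> real ^ 'n) \<Rightarrow> (real ^ 'n \<Rightarrow> real \<Rightarrow> complex ^ 'n ^ 'n)
       \<Rightarrow> real ^ 'n \<Rightarrow> real \<Rightarrow> complex ^ 'n ^ 'n" where
  "generalized_jacobian f \<Theta> x t =
     \<Theta> x t ** map_matrix complex_of_real (state_jacobian f x t) ** matrix_inv (\<Theta> x t) +
     trajectory_derivative f \<Theta> x t ** matrix_inv (\<Theta> x t)"

end

theory Submission
  imports Defs
begin

text \<open>
  In the coordinates \<open>z j = \<Theta> (\<delta> j)\<close> the variational equation becomes \<open>z' = F z\<close> with the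
  generalized Jacobian \<open>F\<close>, so the Gram matrix of the \<open>z j\<close> has the derivative with entries
  \<open>2 * cinner (z j) (H z l)\<close>, where \<open>H\<close> is the Hermitian part of \<open>F\<close>. The squared volume \<open>g\<close> is
  the Gram determinant. The heart of the proof is the inequality
  \<open>g' \<le> 2 * (\<lambda>\<^sub>1 + \<dots> + \<lambda>\<^sub>i) * g\<close>. With the hypothesis on the eigenvalues it
  becomes \<open>g' \<le> - 2 * (\<alpha> + \<gamma>') * g\<close>, so that \<open>g t * exp (2 * \<alpha> * t + 2 * \<gamma> t)\<close> does not
  increase; taking square roots and bounding \<open>\<gamma>\<close> gives the theorem.

  The inequality for \<open>g'\<close> (lemma \<open>det_variation_gram_le\<close>) concerns a single instant. The derivative
  of a determinant depends only on the matrix and its first variation, so the trajectory may be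
  replaced by the flow \<open>exp (s H)\<close>. In an orthonormal eigenbasis of \<open>H\<close> this flow scales the
  coordinates, and the Cauchy-Binet formula (\<open>weighted_cauchy_binet\<close>) writes the Gram determinant
  along it as a sum of squared minors, each multiplied by \<open>exp\<close> of \<open>2 * s\<close> times a sum of \<open>i\<close>
  eigenvalues with distinct indices. Every such sum is at most \<open>\<lambda>\<^sub>1 + \<dots> + \<lambda>\<^sub>i\<close>. This argument does not
  invert the Gram matrix, so linearly dependent displacements need no separate treatment.

  The eigenbasis comes from \<open>hermitian_spectral\<close>, proved by maximising the quadratic form of \<open>H\<close> on
  successive orthogonal complements. It is tied to the eigenvalues ranked with
  multiplicity as roots of the characteristic polynomial by \<open>proots_charpoly_eigenbasis\<close>.
\<close>

unbundle no fps_syntax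

section \<open>The Cauchy-Binet formula and Gram determinants\<close>

text \<open>
  Symmetrising over all maps \<open>\<phi>\<close>, with the factor \<open>fact CARD('i)\<close>, replaces the usual sum over
  \<open>i\<close>-element subsets: each subset is the range of \<open>fact CARD('i)\<close> injective maps, which all
  contribute the same product of minors, and the maps that are not injective contribute 0. In the
  proof, expanding the determinant multilinearly gives one diagonal product of \<open>a\<close> times a minor
  of \<open>b\<close>; reindexing \<open>\<phi>\<close> by every permutation and adding up turns the diagonal products into
  minors of \<open>a\<close>.
\<close>
lemma weighted_cauchy_binet:
  fixes a b :: "'i::finite \<Rightarrow> 'n::finite \<Rightarrow> complex" and w :: "'n \<Rightarrow> complex"
  shows "fact CARD('i) * det (\<chi> j l. \<Sum>k\<in>UNIV. w k * a j k * b l k) =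
    (\<Sum>\<phi>\<in>UNIV. (\<Prod>l\<in>UNIV. w (\<phi> l)) * det (\<chi> j l. a j (\<phi> l)) * det (\<chi> j l. b j (\<phi> l)))"
    (is "_ * det ?G = _")
proof -
  define A where "A \<phi> = (\<chi> j l. a j (\<phi> l))" for \<phi> :: "'i \<Rightarrow> 'n"
  define B where "B \<phi> = (\<chi> j l. b j (\<phi> l))" for \<phi> :: "'i \<Rightarrow> 'n"
  define W where "W \<phi> = (\<Prod>l\<in>UNIV. w (\<phi> l))" for \<phi> :: "'i \<Rightarrow> 'n"
  let ?S = "{\<sigma>. \<sigma> permutes (UNIV :: 'i set)}"
  have "det ?G = (\<Sum>\<sigma>\<in>?S. of_int (sign \<sigma>) *
      (\<Sum>\<phi>\<in>UNIV. \<Prod>j\<in>UNIV. w (\<phi> j) * a j (\<phi> j) * b (\<sigma> j) (\<phi> j)))"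
    by (simp add: det_def prod_sum_PiE)
  also have "\<dots> = (\<Sum>\<phi>\<in>UNIV. W \<phi> * (\<Prod>j\<in>UNIV. a j (\<phi> j)) *
      (\<Sum>\<sigma>\<in>?S. of_int (sign \<sigma>) * (\<Prod>j\<in>UNIV. b (\<sigma> j) (\<phi> j))))"
    unfolding W_def
    by (simp add: sum_distrib_left prod.distrib, subst sum.swap, simp add: mult_ac)
  also have "\<dots> = (\<Sum>\<phi>\<in>UNIV. W \<phi> * (\<Prod>j\<in>UNIV. a j (\<phi> j)) * det (transpose (B \<phi>)))"
    unfolding det_def[of "transpose _"] by (simp add: transpose_def B_def)
  finally have expand: "det ?G = (\<Sum>\<phi>\<in>UNIV. W \<phi> * (\<Prod>j\<in>UNIV. a j (\<phi> j)) * det (B \<phi>))"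
    by simp
  have permuted: "det ?G = (\<Sum>\<phi>\<in>UNIV. W \<phi> * det (B \<phi>) *
      (of_int (sign \<sigma>) * (\<Prod>j\<in>UNIV. a j (\<phi> (\<sigma> j)))))" if \<sigma>: "\<sigma> permutes UNIV" for \<sigma>
  proof -
    have "bij (\<lambda>\<phi> :: 'i \<Rightarrow> 'n. \<phi> \<circ> \<sigma>)"
      by (rule bij_betw_byWitness[where f' = "\<lambda>\<phi>. \<phi> \<circ> inv \<sigma>"])
        (use \<sigma> in \<open>auto simp: fun_eq_iff permutes_inverses\<close>)
    then have "det ?G = (\<Sum>\<phi>\<in>UNIV. W (\<phi> \<circ> \<sigma>) * (\<Prod>j\<in>UNIV. a j ((\<phi> \<circ> \<sigma>) j)) * det (B (\<phi> \<circ> \<sigma>)))"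
      unfolding expand by (rule sum.reindex_bij_betw[symmetric])
    moreover have "W (\<phi> \<circ> \<sigma>) = W \<phi>" for \<phi>
      using prod.permute[OF \<sigma>, of "\<lambda>l. w (\<phi> l)"] by (simp add: W_def o_def)
    moreover have "det (B (\<phi> \<circ> \<sigma>)) = of_int (sign \<sigma>) * det (B \<phi>)" for \<phi>
      using det_permute_columns[OF \<sigma>, of "B \<phi>"] by (simp add: B_def)
    ultimately show ?thesis by (simp add: mult_ac)
  qed
  have "fact CARD('i) * det ?G = (\<Sum>\<sigma>\<in>?S. det ?G)"
    by (simp add: card_permutations)
  also have "\<dots> = (\<Sum>\<sigma>\<in>?S. \<Sum>\<phi>\<in>UNIV. W \<phi> * det (B \<phi>) *
      (of_int (sign \<sigma>) * (\<Prod>j\<in>UNIV. a j (\<phi> (\<sigma> j)))))"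
    by (intro sum.cong refl permuted) auto
  also have "\<dots> = (\<Sum>\<phi>\<in>UNIV. W \<phi> * det (B \<phi>) * det (A \<phi>))"
    unfolding det_def[of "A _"] by (subst sum.swap) (simp add: A_def sum_distrib_left)
  finally show ?thesis by (simp add: A_def B_def W_def mult_ac)
qed

text \<open>
  With nonnegative weights every term is nonnegative. This is what makes the Gram determinant of
  possibly dependent vectors as easy to treat as that of independent ones.
\<close>
lemma det_weighted_gram:
  fixes c :: "'i::finite \<Rightarrow> 'n::finite \<Rightarrow> complex" and w :: "'n \<Rightarrow> real"
  shows "det (\<chi> j l. \<Sum>k\<in>UNIV. of_real (w k) * cnj (c j k) * c l k) =
    of_real ((\<Sum>\<phi>\<in>UNIV. (\<Prod>l\<in>UNIV. w (\<phi> l)) * (cmod (det (\<chi> j l. c j (\<phi> l))))\<^sup>2) / fact CARD('i))"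
proof -
  have "det (\<chi> j l. cnj (c j (\<phi> l))) = cnj (det (\<chi> j l. c j (\<phi> l)))" for \<phi> :: "'i \<Rightarrow> 'n"
    by (simp add: det_def)
  then have "fact CARD('i) * det (\<chi> j l. \<Sum>k\<in>UNIV. of_real (w k) * cnj (c j k) * c l k) =
      of_real (\<Sum>\<phi>\<in>UNIV. (\<Prod>l\<in>UNIV. w (\<phi> l)) * (cmod (det (\<chi> j l. c j (\<phi> l))))\<^sup>2)"
    unfolding weighted_cauchy_binet by (simp add: complex_norm_square mult_ac del: of_real_power)
  then show ?thesis by (simp add: field_simps)
qed

lemma Re_det_gram_matrix_nonneg: "Re (det (gram_matrix z)) \<ge> 0"
proof -
  have "gram_matrix z = (\<chi> j l. \<Sum>k\<in>UNIV. of_real 1 * cnj (z j $ k) * z l $ k)"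
    by (simp add: gram_matrix_def cinner_def)
  then show ?thesis
    unfolding \<open>gram_matrix z = _\<close> det_weighted_gram[of "\<lambda>_. 1" "\<lambda>j k. z j $ k"] Re_complex_of_real
    by (simp add: sum_nonneg)
qed

section \<open>The Hermitian inner product\<close>

lemma cinner_simps:
  "cinner u (v + w) = cinner u v + cinner u w"
  "cinner (u + v) w = cinner u w + cinner v w"
  "cinner u (v - w) = cinner u v - cinner u w"
  "cinner u (c *s v) = c * cinner u v"
  "cinner (c *s u) v = cnj c * cinner u v"
  "cinner u (r *\<^sub>R v) = of_real r * cinner u v"
  "cinner (r *\<^sub>R u) v = of_real r * cinner u v"
  "cinner u 0 = 0"
  by (simp_all add: cinner_def algebra_simps sum.distrib sum_subtractf sum_distrib_left
      scaleR_conv_of_real[where 'a = complex])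

lemma cnj_cinner: "cnj (cinner u v) = cinner v u"
  by (simp add: cinner_def mult.commute)

lemma Re_cinner: "Re (cinner u v) = u \<bullet> v"
  by (simp add: cinner_def inner_vec_def inner_complex_def)

lemma cinner_self: "cinner u u = of_real ((norm u)\<^sup>2)"
  by (rule complex_eqI)
    (use cnj_cinner[of u u] in \<open>simp_all add: Re_cinner power2_norm_eq_inner complex_eq_iff\<close>)

lemma cinner_matrix_vector: "cinner (A *v u) v = cinner u (conj_transpose A *v v)"
  unfolding cinner_def conj_transpose_def matrix_vector_mult_def transpose_def map_matrix_def
  by (simp add: sum_distrib_left sum_distrib_right, subst sum.swap, simp add: mult_ac)

lemma conj_transpose_twice [simp]: "conj_transpose (conj_transpose A) = A"
  by (simp add: conj_transpose_def map_matrix_def transpose_def vec_eq_iff)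

lemma conj_transpose_hermitian_part [simp]:
  "conj_transpose (hermitian_part A) = hermitian_part A"
  by (simp add: hermitian_part_def conj_transpose_def map_matrix_def transpose_def vec_eq_iff add.commute)

section \<open>Spectral theorem for Hermitian matrices\<close>

lemma complex_matrix_vector_scaleR:
  "(A :: complex ^ 'n ^ 'm) *v (r *\<^sub>R v) = r *\<^sub>R (A *v v)"
  by (simp add: vec_eq_iff matrix_vector_mult_def scaleR_sum_right)

lemma scaleR_complex_matrix_vector:
  "(r *\<^sub>R (A :: complex ^ 'n ^ 'm)) *v v = r *\<^sub>R (A *v v)"
  by (simp add: vec_eq_iff matrix_vector_mult_def scaleR_sum_right)

text \<open>
  A maximiser \<open>v\<close> of the quadratic form \<open>v \<mapsto> Re (cinner v (H *v v))\<close> on the unit sphere of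
  \<open>W\<close>, with maximum \<open>d\<close>, is an eigenvector: a step \<open>s\<close> from \<open>v\<close> along the residual
  \<open>y = H *v v - d *\<^sub>R v\<close> stays in \<open>W\<close> and would raise the form above \<open>d\<close> times the squared norm by
  \<open>2 * s * (norm y)\<^sup>2\<close> up to terms of second order in \<open>s\<close>, so \<open>y\<close> must vanish.
\<close>
lemma hermitian_eigenvector_in_invariant_subspace:
  fixes H :: "complex ^ 'n ^ 'n"
  assumes H: "conj_transpose H = H"
    and W: "closed W" "\<And>u v. u \<in> W \<Longrightarrow> v \<in> W \<Longrightarrow> u + v \<in> W"
      "\<And>r v. v \<in> W \<Longrightarrow> r *\<^sub>R v \<in> W" "\<And>v. v \<in> W \<Longrightarrow> H *v v \<in> W"
    and "w \<in> W" "w \<noteq> 0"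
  obtains v d where "v \<in> W" "norm v = 1" "H *v v = of_real d *s v"
proof -
  define q where "q v = Re (cinner v (H *v v))" for v
  let ?K = "W \<inter> sphere 0 1"
  have "compact ?K" using W(1) by (simp add: closed_Int_compact)
  moreover have "(1 / norm w) *\<^sub>R w \<in> ?K"
    using assms by (auto simp: W(3))
  moreover have "continuous_on ?K q"
    unfolding q_def cinner_def matrix_vector_mult_def by (intro continuous_intros)
  ultimately obtain v where v: "v \<in> ?K" and max: "\<And>u. u \<in> ?K \<Longrightarrow> q u \<le> q v"
    using continuous_attains_sup[of ?K q] by blast
  define d where "d = q v"
  have vW: "v \<in> W" and nv: "norm v = 1" using v by auto
  have q_scale: "q (r *\<^sub>R u) = r\<^sup>2 * q u" for r u
    by (simp add: q_def cinner_simps complex_matrix_vector_scaleR power2_eq_square)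
  have q_le: "q u \<le> d * (norm u)\<^sup>2" if "u \<in> W" for u
  proof (cases "u = 0")
    case False
    then have "(1 / norm u) *\<^sub>R u \<in> ?K" using that by (auto simp: W(3))
    then have "q ((1 / norm u) *\<^sub>R u) \<le> d" using max by (simp add: d_def)
    then show ?thesis using False by (simp add: q_scale field_simps)
  qed (simp add: q_def cinner_simps)
  define y where "y = H *v v - d *\<^sub>R v"
  have yW: "y \<in> W"
    using W(2)[OF W(4)[OF vW] W(3)[OF vW, of "- d"]] by (simp add: y_def)
  have sym: "Re (cinner v (H *v y)) = Re (cinner y (H *v v))"
    by (metis H Re_cinner cinner_matrix_vector inner_commute)
  define e where "e = d * (norm y)\<^sup>2 - q y"
  \<comment> \<open>maximality of \<open>d\<close> at \<open>v + s *\<^sub>R y\<close>; the linear term in \<open>s\<close> has to be absorbed by the quadratic one\<close>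
  have quad: "2 * s * (norm y)\<^sup>2 \<le> s\<^sup>2 * e" for s
  proof -
    have "v + s *\<^sub>R y \<in> W" using W vW yW by blast
    from q_le[OF this] have "q (v + s *\<^sub>R y) \<le> d * ((v + s *\<^sub>R y) \<bullet> (v + s *\<^sub>R y))"
      by (simp add: power2_norm_eq_inner)
    also have "(v + s *\<^sub>R y) \<bullet> (v + s *\<^sub>R y) = 1 + 2 * s * (y \<bullet> v) + s\<^sup>2 * (norm y)\<^sup>2"
      using nv by (simp add: inner_simps power2_norm_eq_inner norm_eq_1 algebra_simps inner_commute power2_eq_square[of s])
    also have "q (v + s *\<^sub>R y) = d + 2 * s * (y \<bullet> (H *v v)) + s\<^sup>2 * q y"
      using sym unfolding q_def d_def
      by (simp add: matrix_vector_right_distrib complex_matrix_vector_scaleR cinner_simps algebra_simps power2_eq_square Re_cinner)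
    also have "y \<bullet> (H *v v) = (norm y)\<^sup>2 + d * (y \<bullet> v)"
      unfolding power2_norm_eq_inner by (subst (3) y_def) (simp add: inner_simps)
    finally show ?thesis by (simp add: e_def algebra_simps)
  qed
  have "(norm y)\<^sup>2 \<le> 0"
  proof (rule ccontr)
    assume "\<not> (norm y)\<^sup>2 \<le> 0"
    then have pos: "(norm y)\<^sup>2 > 0" by simp
    \<comment> \<open>a step small enough for the linear term to win, whatever the sign of \<open>e\<close>\<close>
    define s where "s = (norm y)\<^sup>2 / (\<bar>e\<bar> + 1)"
    have "s > 0" using pos unfolding s_def by (intro divide_pos_pos) linarith+
    moreover have "s * \<bar>e\<bar> + s = (norm y)\<^sup>2"
      unfolding s_def by (simp add: field_simps add_nonneg_eq_0_iff)
    ultimately have s: "s > 0" "s * \<bar>e\<bar> < (norm y)\<^sup>2 * 2" using pos by linarith+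
    have "s * (2 * (norm y)\<^sup>2) \<le> s * (s * e)" using quad[of s] by (simp add: power2_eq_square algebra_simps)
    then have "2 * (norm y)\<^sup>2 \<le> s * e" using s(1) by simp
    also have "\<dots> \<le> s * \<bar>e\<bar>" using s(1) by simp
    finally show False using s(2) by simp
  qed
  then have "H *v v = of_real d *s v"
    by (simp add: y_def vec_eq_iff scaleR_conv_of_real[where 'a = complex])
  with that vW nv show ?thesis by blast
qed

text \<open>
  An orthonormal family of fewer than \<open>CARD('n)\<close> eigenvectors can be enlarged, because its
  orthogonal complement is a nonzero subspace that \<open>H\<close> maps into itself.
\<close>
lemma orthonormal_eigenvectors:
  fixes H :: "complex ^ 'n ^ 'n"
  assumes H: "conj_transpose H = H" and "m \<le> CARD('n)"
  shows "\<exists>B. finite B \<and> card B = m \<and> (\<forall>u\<in>B. \<forall>v\<in>B. cinner u v = (if u = v then 1 else 0)) \<and>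
    (\<forall>u\<in>B. \<exists>d. H *v u = of_real d *s u)"
  using assms(2)
proof (induction m)
  case (Suc m)
  then obtain B where B: "finite B" "card B = m"
    "\<And>u v. u \<in> B \<Longrightarrow> v \<in> B \<Longrightarrow> cinner u v = (if u = v then 1 else 0)"
    "\<And>u. u \<in> B \<Longrightarrow> \<exists>d. H *v u = of_real d *s u" by auto
  define W where "W = {v. \<forall>u. u \<in> B \<longrightarrow> cinner u v = 0}"
  \<comment> \<open>complex orthogonality to \<open>B\<close> is real orthogonality to \<open>B\<close> and to \<open>\<i> B\<close>; real dimensions count double\<close>
  let ?R = "B \<union> (\<lambda>u. \<i> *s u) ` B"
  have "dim ?R \<le> card ?R" using B(1) by (intro dim_le_card') auto
  also have "\<dots> \<le> m + m" using card_Un_le[of B "(\<lambda>u. \<i> *s u) ` B"] card_image_le[OF B(1), of "\<lambda>u. \<i> *s u"] B(2) by linarith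
  also have "\<dots> < DIM(complex ^ 'n)" using Suc.prems by simp
  finally obtain w where w: "w \<noteq> 0" "\<And>y. y \<in> span ?R \<Longrightarrow> orthogonal w y"
    using orthogonal_to_subspace_exists by blast
  have "cinner u w = 0" if "u \<in> B" for u
  proof (rule complex_eqI)
    show "Re (cinner u w) = Re 0"
      using w(2)[of u] that by (simp add: Re_cinner orthogonal_def inner_commute span_base)
    have "Re (cinner (\<i> *s u) w) = 0"
      using w(2)[of "\<i> *s u"] that by (simp add: Re_cinner orthogonal_def inner_commute span_base)
    then show "Im (cinner u w) = Im 0" by (simp add: cinner_simps)
  qed
  then have "w \<in> W" by (simp add: W_def)
  moreover have "closed W"
    unfolding W_def cinner_def by (intro closed_Collect_all closed_Collect_imp open_Collect_const closed_Collect_eq continuous_intros)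
  moreover have "H *v v \<in> W" if "v \<in> W" for v
    unfolding W_def
  proof safe
    fix u assume u: "u \<in> B"
    then obtain d where "H *v u = of_real d *s u" using B(4) by blast
    moreover have "cinner u (H *v v) = cinner (H *v u) v" by (simp add: cinner_matrix_vector H)
    ultimately show "cinner u (H *v v) = 0" using that u by (simp add: cinner_simps W_def)
  qed
  moreover have "u + v \<in> W" "r *\<^sub>R v \<in> W" if "u \<in> W" "v \<in> W" for u v r
    using that by (simp_all add: W_def cinner_simps)
  ultimately obtain v d where v: "v \<in> W" "norm v = 1" "H *v v = of_real d *s v"
    using hermitian_eigenvector_in_invariant_subspace[OF H, of W w] w(1) by metis
  have vv: "cinner v v = 1" by (simp add: cinner_self v(2))
  have uv: "cinner u v = 0" "cinner v u = 0" if "u \<in> B" for u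
    using v(1) that cnj_cinner[of u v] by (auto simp: W_def)
  have "v \<notin> B" using vv uv by force
  then show ?case
    by (intro exI[of _ "insert v B"]) (use B vv uv v(3) in auto)
qed auto

theorem hermitian_spectral:
  fixes H :: "complex ^ 'n ^ 'n"
  assumes H: "conj_transpose H = H"
  shows "\<exists>(u :: 'n \<Rightarrow> complex ^ 'n) (d :: 'n \<Rightarrow> real).
    (\<forall>k l. cinner (u k) (u l) = (if k = l then 1 else 0)) \<and> (\<forall>k. H *v u k = of_real (d k) *s u k)"
proof -
  obtain B where B: "finite B" "card B = CARD('n)"
    "\<And>u v. u \<in> B \<Longrightarrow> v \<in> B \<Longrightarrow> cinner u v = (if u = v then 1 else 0)"
    "\<And>u. u \<in> B \<Longrightarrow> \<exists>d. H *v u = of_real d *s u"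
    using orthonormal_eigenvectors[OF H order_refl] by blast
  then obtain u where u: "bij_betw u (UNIV :: 'n set) B"
    using finite_same_card_bij[of "UNIV :: 'n set" B] by auto
  then have uB: "u k \<in> B" for k by (auto simp: bij_betw_def)
  have "inj u" using u by (simp add: bij_betw_def)
  then have "cinner (u k) (u l) = (if k = l then 1 else 0)" for k l
    using B(3) uB by (auto dest: injD)
  moreover obtain d where "\<And>k. H *v u k = of_real (d k) *s u k"
    using B(4)[OF uB] by metis
  ultimately show ?thesis by blast
qed

section \<open>The characteristic polynomial and ranked eigenvalues\<close>

definition column_matrix :: "('n \<Rightarrow> complex ^ 'n) \<Rightarrow> complex ^ 'n ^ 'n" where
  "column_matrix u = (\<chi> r k. u k $ r)"

lemma column_matrix_unitary:
  fixes u :: "'n::finite \<Rightarrow> complex ^ 'n"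
  assumes "\<And>k l. cinner (u k) (u l) = (if k = l then 1 else 0)"
  shows "conj_transpose (column_matrix u) ** column_matrix u = mat 1"
    "column_matrix u ** conj_transpose (column_matrix u) = mat 1"
proof -
  show 1: "conj_transpose (column_matrix u) ** column_matrix u = mat 1"
    using assms by (simp add: vec_eq_iff matrix_matrix_mult_def conj_transpose_def column_matrix_def
        transpose_def map_matrix_def mat_def cinner_def)
  then show "column_matrix u ** conj_transpose (column_matrix u) = mat 1"
    using matrix_left_right_inverse by blast
qed

text \<open>
  Used to pass to the coordinates of an eigenbasis, in which a Hermitian matrix acts by scaling.
\<close>
lemma parseval:
  fixes u :: "'n::finite \<Rightarrow> complex ^ 'n"
  assumes "\<And>k l. cinner (u k) (u l) = (if k = l then 1 else 0)"
  shows "cinner x y = (\<Sum>k\<in>UNIV. cnj (cinner (u k) x) * cinner (u k) y)"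
proof -
  let ?P = "column_matrix u"
  have "cinner x y = cinner (conj_transpose ?P *v x) (conj_transpose ?P *v y)"
    by (simp add: cinner_matrix_vector matrix_vector_mul_assoc column_matrix_unitary(2)[OF assms])
  also have "\<dots> = (\<Sum>k\<in>UNIV. cnj (cinner (u k) x) * cinner (u k) y)"
    by (simp add: cinner_def matrix_vector_mult_def conj_transpose_def column_matrix_def
        transpose_def map_matrix_def)
  finally show ?thesis .
qed

lemma map_matrix_poly_mult:
  "map_matrix (\<lambda>a. [:a:]) (A ** B) = map_matrix (\<lambda>a. [:a:]) A ** map_matrix (\<lambda>a. [:a:]) (B :: complex ^ 'n ^ 'n)"
proof -
  have const_sum: "[:sum g S:] = (\<Sum>k\<in>S. [:g k:])" for g :: "'n \<Rightarrow> complex" and S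
  proof (induction S rule: infinite_finite_induct)
    case (insert x S)
    have "[:sum g (insert x S):] = [:g x:] + [:sum g S:]"
      using insert.hyps by simp
    then show ?case
      using insert by simp
  qed simp_all
  show ?thesis
    unfolding map_matrix_def matrix_matrix_mult_def vec_eq_iff
    by (simp add: const_sum mult.commute)
qed

lemma mat_matrix_commute: "mat c ** (A :: 'a::comm_ring_1 ^ 'n ^ 'n) = A ** mat c"
  by (simp add: vec_eq_iff matrix_matrix_mult_def mat_def if_distrib if_distribR mult.commute cong: if_cong)

lemma matrix_diff_ldistrib: "A ** (B - C) = A ** B - A ** (C :: 'a::ring_1 ^ 'n ^ 'm)"
  by (simp add: vec_eq_iff matrix_matrix_mult_def algebra_simps sum_subtractf)

lemma matrix_diff_rdistrib: "(B - C) ** A = B ** A - C ** (A :: 'a::ring_1 ^ 'n ^ 'm)"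
  by (simp add: vec_eq_iff matrix_matrix_mult_def algebra_simps sum_subtractf)

lemma charpoly_similar:
  fixes A P Q :: "complex ^ 'n ^ 'n"
  assumes "Q ** P = mat 1"
  shows "charpoly (Q ** A ** P) = charpoly A"
proof -
  let ?c = "map_matrix (\<lambda>a. [:a:]) :: complex ^ 'n ^ 'n \<Rightarrow> _"
  have one: "?c Q ** ?c P = mat 1"
    by (simp add: assms flip: map_matrix_poly_mult)
      (simp add: map_matrix_def mat_def vec_eq_iff one_pCons)
  have "?c Q ** (mat [:0, 1:] - ?c A) ** ?c P = mat [:0, 1:] ** (?c Q ** ?c P) - ?c (Q ** A ** P)"
    unfolding matrix_diff_ldistrib matrix_diff_rdistrib map_matrix_poly_mult mat_matrix_commute[of _ "?c Q", symmetric]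
    by (simp only: matrix_mul_assoc)
  then have "charpoly (Q ** A ** P) = det (?c Q ** (mat [:0, 1:] - ?c A) ** ?c P)"
    by (simp add: charpoly_def one)
  also have "\<dots> = det (?c Q ** ?c P) * charpoly A"
    by (simp add: det_mul charpoly_def mult_ac)
  finally show ?thesis by (simp add: one)
qed

text \<open>
  The unitary matrix of the eigenbasis diagonalises \<open>A\<close>, and similar matrices share their
  characteristic polynomial; that of a diagonal matrix is a product of linear factors.
\<close>
lemma proots_charpoly_eigenbasis:
  fixes A :: "complex ^ 'n ^ 'n" and u :: "'n \<Rightarrow> complex ^ 'n"
  assumes on: "\<And>k l. cinner (u k) (u l) = (if k = l then 1 else 0)"
    and eig: "\<And>k. A *v u k = d k *s u k"
  shows "proots (charpoly A) = image_mset d (mset_set UNIV)"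
proof -
  let ?P = "column_matrix u"
  define D :: "complex ^ 'n ^ 'n" where "D = (\<chi> k l. if k = l then d k else 0)"
  have "A ** ?P = ?P ** D"
  proof -
    have "(\<Sum>m\<in>UNIV. A $ r $ m * u k $ m) = u k $ r * d k" for r k
      using arg_cong[OF eig[of k], of "\<lambda>v. v $ r"] by (simp add: matrix_vector_mult_def)
    then show ?thesis
      by (simp add: vec_eq_iff matrix_matrix_mult_def column_matrix_def D_def if_distrib cong: if_cong)
  qed
  then have "conj_transpose ?P ** A ** ?P = D"
    by (simp add: column_matrix_unitary(1)[OF on] flip: matrix_mul_assoc)
      (simp add: column_matrix_unitary(1)[OF on] matrix_mul_assoc)
  then have "charpoly A = charpoly D"
    using charpoly_similar[OF column_matrix_unitary(1)[OF on], of A] by simp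
  also have "\<dots> = (\<Prod>k\<in>UNIV. [:- d k, 1:])"
    unfolding charpoly_def by (subst det_diagonal) (auto simp: D_def mat_def map_matrix_def)
  finally show ?thesis by (simp add: proots_prod sum_unfold_sum_mset)
qed

lemma sum_mset_le_sum_list_take:
  fixes xs :: "real list"
  assumes "sorted (rev xs)" "N \<subseteq># mset xs"
  shows "sum_mset N \<le> sum_list (take (size N) xs)"
  using assms
proof (induction xs arbitrary: N)
  case (Cons x xs)
  \<comment> \<open>the head \<open>x\<close> is matched with an element \<open>y\<close> of \<open>N\<close>: with itself if possible, so that what remains fits into \<open>xs\<close>\<close>
  show ?case
  proof (cases "N = {#}")
    case False
    then obtain y where y: "y \<in># N" "x \<in># N \<Longrightarrow> y = x" by blast
    have le: "y \<le> x"
      using y(1) Cons.prems mset_subset_eqD[of N "mset (x # xs)" y] by (auto simp: sorted_append)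
    have "N - {#y#} \<subseteq># mset xs"
    proof (cases "x \<in># N")
      case True
      then show ?thesis using y Cons.prems(2) by (simp add: subset_eq_diff_conv)
    next
      case False
      then have "N \<subseteq># mset xs"
        using Cons.prems(2) subset_eq_diff_conv[of N "{#x#}" "mset xs"]
        by (simp add: diff_single_trivial)
      then show ?thesis by (meson diff_subset_eq_self subset_mset.order_trans)
    qed
    then have "sum_mset (N - {#y#}) \<le> sum_list (take (size (N - {#y#})) xs)"
      using Cons.IH Cons.prems(1) by (simp add: sorted_append)
    moreover have "N = add_mset y (N - {#y#})" using y(1) by simp
    ultimately show ?thesis using le
      by (metis add_mono size_add_mset sum_list.Cons sum_mset.add_mset take_Suc_Cons)
  qed simp
qed simp

text \<open>
  The link between an arbitrary orthonormal eigenbasis and the ranked eigenvalues of the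
  characteristic polynomial: an injective \<open>\<phi>\<close> selects a submultiset of the spectrum, and no
  selection of this size has a larger sum than the largest entries.
\<close>
lemma sum_eigenvalues_le_ranked:
  fixes H :: "complex ^ 'n ^ 'n" and u :: "'n \<Rightarrow> complex ^ 'n" and \<phi> :: "'i::finite \<Rightarrow> 'n"
  assumes on: "\<And>k l. cinner (u k) (u l) = (if k = l then 1 else 0)"
    and eig: "\<And>k. H *v u k = of_real (d k) *s u k" and "inj \<phi>"
  shows "(\<Sum>l\<in>UNIV. d (\<phi> l)) \<le> (\<Sum>k=1..CARD('i). ranked_eigenvalue H k)"
proof -
  let ?N = "image_mset d (mset_set (range \<phi>))"
  have mset: "mset (ranked_eigenvalues H) = image_mset d (mset_set UNIV)"
    unfolding ranked_eigenvalues_def proots_charpoly_eigenbasis[of u, OF on eig]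
    by (simp add: image_mset.compositionality o_def)
  have size: "size ?N = CARD('i)" using \<open>inj \<phi>\<close> by (simp add: card_image)
  have "(\<Sum>l\<in>UNIV. d (\<phi> l)) = sum_mset ?N"
    using \<open>inj \<phi>\<close> by (simp add: sum.reindex flip: sum_unfold_sum_mset)
  also have "\<dots> \<le> sum_list (take CARD('i) (ranked_eigenvalues H))"
    unfolding size[symmetric]
  proof (rule sum_mset_le_sum_list_take)
    show "sorted (rev (ranked_eigenvalues H))" by (simp add: ranked_eigenvalues_def)
    show "?N \<subseteq># mset (ranked_eigenvalues H)"
      unfolding mset by (intro image_mset_subseteq_mono) (simp add: subset_imp_msubset_mset_set)
  qed
  also have "\<dots> = (\<Sum>k<CARD('i). ranked_eigenvalues H ! k)"
  proof -
    have "CARD('i) \<le> length (ranked_eigenvalues H)"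
      using \<open>inj \<phi>\<close> arg_cong[OF mset, of size] by (simp add: card_inj_on_le[of \<phi> UNIV UNIV])
    then show ?thesis by (simp add: sum_list_sum_nth min_def atLeast0LessThan)
  qed
  also have "\<dots> = (\<Sum>k=1..CARD('i). ranked_eigenvalue H k)"
    by (rule sum.reindex_bij_witness[of _ "\<lambda>k. k - 1" Suc]) (auto simp: ranked_eigenvalue_def)
  finally show ?thesis .
qed

section \<open>First variation of Gram determinants\<close>

text \<open>
  The derivative of \<open>det\<close> at \<open>A\<close> in the direction \<open>A'\<close>. It is kept as an explicit function of
  \<open>A\<close> and \<open>A'\<close> because it is evaluated below along a different curve with the same first-order
  data.
\<close>
definition det_variation :: "complex ^ 'i ^ 'i \<Rightarrow> complex ^ 'i ^ 'i \<Rightarrow> complex" where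
  "det_variation A A' = (\<Sum>\<sigma> | \<sigma> permutes UNIV. of_int (sign \<sigma>) *
     (\<Sum>j\<in>UNIV. A' $ j $ \<sigma> j * (\<Prod>m\<in>UNIV - {j}. A $ m $ \<sigma> m)))"

lemma has_vector_derivative_det:
  fixes A :: "real \<Rightarrow> complex ^ 'i ^ 'i"
  assumes "\<And>j l. ((\<lambda>s. A s $ j $ l) has_vector_derivative A' $ j $ l) (at t within S)"
  shows "((\<lambda>s. det (A s)) has_vector_derivative det_variation (A t) A') (at t within S)"
proof -
  have "((\<lambda>s. \<Prod>j\<in>UNIV. A s $ j $ \<sigma> j) has_derivative
      (\<lambda>h. \<Sum>j\<in>UNIV. (h *\<^sub>R A' $ j $ \<sigma> j) * (\<Prod>m\<in>UNIV - {j}. A t $ m $ \<sigma> m))) (at t within S)" for \<sigma>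
    using assms by (intro has_derivative_prod) (simp add: has_vector_derivative_def)
  then have "((\<lambda>s. \<Prod>j\<in>UNIV. A s $ j $ \<sigma> j) has_vector_derivative
      (\<Sum>j\<in>UNIV. A' $ j $ \<sigma> j * (\<Prod>m\<in>UNIV - {j}. A t $ m $ \<sigma> m))) (at t within S)" for \<sigma>
    by (simp add: has_vector_derivative_def scaleR_sum_right)
  then show ?thesis
    unfolding det_def det_variation_def
    by (intro has_vector_derivative_sum has_vector_derivative_mult_right)
qed

text \<open>
  The infinitesimal form of the theorem: under the flow of a Hermitian matrix \<open>H\<close>, squared volumes
  grow at most at twice the sum of the largest eigenvalues. In coordinates of an eigenbasis this
  flow multiplies the \<open>k\<close>-th coordinate by \<open>exp (s * d k)\<close>. Hence the Gram determinant along it is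
  a sum of squared minors, the minor selected by \<open>\<phi>\<close> being scaled by \<open>exp\<close> of \<open>s\<close> times the sum of the
  selected eigenvalues. Only selections without repeated indices have a nonzero minor, and their sums
  are bounded by that of the largest eigenvalues.
  At \<open>s = 0\<close> the curve has the Gram matrix of \<open>z\<close> and the prescribed variation.
\<close>
lemma det_variation_gram_le:
  fixes z :: "'i::finite \<Rightarrow> complex ^ 'n"
  assumes H: "conj_transpose H = H"
  shows "Re (det_variation (gram_matrix z) (\<chi> j l. 2 * cinner (z j) (H *v z l)))
    \<le> 2 * (\<Sum>k=1..CARD('i). ranked_eigenvalue H k) * Re (det (gram_matrix z))"
proof -
  obtain u :: "'n \<Rightarrow> complex ^ 'n" and d :: "'n \<Rightarrow> real"
    where ud: "\<forall>k l. cinner (u k) (u l) = (if k = l then 1 else 0)"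
      "\<forall>k. H *v u k = of_real (d k) *s u k"
    using hermitian_spectral[OF H] by blast
  note on = ud(1)[rule_format] and eig = ud(2)[rule_format]
  define \<Lambda> where "\<Lambda> = (\<Sum>k=1..CARD('i). ranked_eigenvalue H k)"
  define c where "c j k = cinner (u k) (z j)" for j k
  define q where "q \<phi> = (cmod (det (\<chi> j l. c j (\<phi> l))))\<^sup>2" for \<phi> :: "'i \<Rightarrow> 'n"
  define D where "D \<phi> = (\<Sum>l\<in>UNIV. d (\<phi> l))" for \<phi> :: "'i \<Rightarrow> 'n"
  define M where "M s = (\<chi> j l. \<Sum>k\<in>UNIV. of_real (exp (2 * s * d k)) * cnj (c j k) * c l k)" for s
  define p where "p s = (\<Sum>\<phi>\<in>UNIV. exp (2 * s * D \<phi>) * q \<phi>) / fact CARD('i)" for s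
  have "cinner (z j) (z l) = (\<Sum>k\<in>UNIV. cnj (c j k) * c l k)" for j l
    unfolding c_def by (rule parseval) (rule on)
  then have M0: "M 0 = gram_matrix z"
    by (simp add: M_def gram_matrix_def)
  have det_M: "det (M s) = of_real (p s)" for s
    unfolding M_def p_def q_def D_def
    by (subst det_weighted_gram) (simp add: sum_distrib_left exp_sum)
  have coeff: "2 * cinner (z j) (H *v z l) = (\<Sum>k\<in>UNIV. of_real (2 * d k) * cnj (c j k) * c l k)" for j l
  proof -
    have "cinner (u k) (H *v z l) = of_real (d k) * c l k" for k
      using cinner_matrix_vector[of H "u k" "z l"] by (simp add: H eig cinner_simps c_def)
    then show ?thesis
      unfolding parseval[of u, OF on, of "z j"] by (simp add: c_def sum_distrib_left mult_ac)
  qed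
  have "((\<lambda>s. M s $ j $ l) has_vector_derivative (\<chi> j l. 2 * cinner (z j) (H *v z l)) $ j $ l) (at 0)" for j l
    unfolding M_def coeff
    by simp (rule derivative_eq_intros has_vector_derivative_real_field refl | simp)+
  then have "((\<lambda>s. det (M s)) has_vector_derivative
      det_variation (gram_matrix z) (\<chi> j l. 2 * cinner (z j) (H *v z l))) (at 0)"
    using has_vector_derivative_det[of M _ 0 UNIV] M0 by simp
  moreover have "(p has_real_derivative (\<Sum>\<phi>\<in>UNIV. 2 * D \<phi> * q \<phi>) / fact CARD('i)) (at 0)"
    unfolding p_def by (rule derivative_eq_intros refl | simp)+
  then have "((\<lambda>s. det (M s)) has_vector_derivative
      of_real ((\<Sum>\<phi>\<in>UNIV. 2 * D \<phi> * q \<phi>) / fact CARD('i))) (at 0)"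
    unfolding det_M by (intro has_vector_derivative_of_real) (simp add: has_real_derivative_iff_has_vector_derivative)
  ultimately have "det_variation (gram_matrix z) (\<chi> j l. 2 * cinner (z j) (H *v z l)) =
      of_real ((\<Sum>\<phi>\<in>UNIV. 2 * D \<phi> * q \<phi>) / fact CARD('i))"
    by (rule vector_derivative_unique_at)
  then have "Re (det_variation (gram_matrix z) (\<chi> j l. 2 * cinner (z j) (H *v z l))) =
      (\<Sum>\<phi>\<in>UNIV. 2 * D \<phi> * q \<phi>) / fact CARD('i)"
    by (metis Re_complex_of_real)
  also have "\<dots> \<le> (\<Sum>\<phi>\<in>UNIV. 2 * \<Lambda> * q \<phi>) / fact CARD('i)"
  proof (intro divide_right_mono sum_mono)
    fix \<phi> :: "'i \<Rightarrow> 'n"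
    show "2 * D \<phi> * q \<phi> \<le> 2 * \<Lambda> * q \<phi>"
    proof (cases "inj \<phi>")
      case True
      then have "D \<phi> \<le> \<Lambda>"
        using sum_eigenvalues_le_ranked[of u, OF on eig] by (simp add: D_def \<Lambda>_def)
      then show ?thesis by (simp add: q_def mult_right_mono)
    next
      case False
      then obtain l m where "l \<noteq> m" "\<phi> l = \<phi> m" by (auto simp: inj_def)
      then have "det (\<chi> j l. c j (\<phi> l)) = 0"
        by (intro det_identical_columns[of l m]) (auto simp: column_def)
      then show ?thesis by (simp add: q_def)
    qed
  qed simp
  also have "\<dots> = 2 * \<Lambda> * Re (det (gram_matrix z))"
  proof -
    have "Re (det (gram_matrix z)) = p 0" by (metis M0 det_M Re_complex_of_real)
    then show ?thesis by (simp add: p_def sum_distrib_left)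
  qed
  finally show ?thesis by (simp add: \<Lambda>_def)
qed

section \<open>Derivatives along a trajectory\<close>

lemma has_vector_derivative_vec_iff:
  fixes g :: "real \<Rightarrow> 'a::euclidean_space ^ 'n"
  shows "(g has_vector_derivative g') (at t within S) \<longleftrightarrow>
    (\<forall>k. ((\<lambda>s. g s $ k) has_vector_derivative g' $ k) (at t within S))" (is "?L \<longleftrightarrow> ?R")
proof
  assume ?L
  then show ?R
    using bounded_linear.has_vector_derivative[OF bounded_linear_vec_nth] by blast
next
  assume R: ?R
  have "((\<lambda>s. g s \<bullet> b) has_derivative (\<lambda>h. (h *\<^sub>R g') \<bullet> b)) (at t within S)" if "b \<in> Basis" for b
  proof -
    obtain k e where "b = axis k e" using \<open>b \<in> Basis\<close> by (auto simp: Basis_vec_def)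
    moreover have "((\<lambda>s. g s $ k) has_derivative (\<lambda>h. h *\<^sub>R g' $ k)) (at t within S)"
      using R by (simp add: has_vector_derivative_def)
    ultimately show ?thesis
      by (auto simp: inner_axis dest: has_derivative_inner_left[where b = e])
  qed
  then show ?L
    by (simp add: has_vector_derivative_def has_derivative_componentwise_within[of g])
qed

text \<open>
  The chain rule for \<open>s \<mapsto> (x s, s)\<close>. The total derivative \<open>D\<close> of \<open>\<Theta>\<close> splits into the partial
  derivatives that make up \<open>trajectory_derivative\<close>; these are derivatives along the two slices
  through \<open>(x t, t)\<close>.
\<close>
lemma has_vector_derivative_along_solution:
  fixes f :: "real ^ 'n \<Rightarrow> real \<Rightarrow> real ^ 'n"
  assumes C1: "C1_on (\<lambda>(x, t). \<Theta> x t) (U \<times> {0..})" and "open U"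
    and sol: "solution_on f U {0..} x" and t: "t \<ge> 0"
  shows "((\<lambda>s. \<Theta> (x s) s) has_vector_derivative trajectory_derivative f \<Theta> (x t) t) (at t within {0..})"
proof -
  let ?\<Theta> = "\<lambda>(x, t). \<Theta> x t"
  have x: "x s \<in> U" "(x has_vector_derivative f (x s) s) (at s within {0..})" if "s \<ge> 0" for s
    using sol that by (auto simp: solution_on_def)
  obtain D where D: "(?\<Theta> has_derivative D) (at (x t, t) within U \<times> {0..})"
    using C1 x(1)[OF t] t unfolding C1_on_def by fastforce
  interpret D: linear D using D has_derivative_linear by blast
  have comp: "((\<lambda>s. ?\<Theta> (g s)) has_derivative (\<lambda>h. D (g' h))) (at a within T)"
    if "(g has_derivative g') (at a within T)" "g a = (x t, t)" "g ` T \<subseteq> U \<times> {0..}"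
    for g :: "'z::real_normed_vector \<Rightarrow> _" and g' a T
    by (rule has_derivative_in_compose[OF that(1)]) (use that D in \<open>auto intro: has_derivative_subset\<close>)
  have "((\<lambda>s. ?\<Theta> (x s, s)) has_derivative (\<lambda>h. D (h *\<^sub>R f (x t) t, h))) (at t within {0..})"
    by (rule comp) (use x t in \<open>auto intro!: has_derivative_Pair simp: has_vector_derivative_def\<close>)
  then have along: "((\<lambda>s. \<Theta> (x s) s) has_vector_derivative D (f (x t) t, 1)) (at t within {0..})"
    by (simp add: has_vector_derivative_def flip: D.scale)
  have "((\<lambda>s. ?\<Theta> (x t, s)) has_derivative (\<lambda>h. D (0, h))) (at t within {0..})"
    by (rule comp) (use x t in \<open>auto intro!: has_derivative_Pair\<close>)
  then have "((\<lambda>s. \<Theta> (x t) s) has_vector_derivative D (0, 1)) (at t within {0..})"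
    by (simp add: has_vector_derivative_def flip: D.scale)
  then have time: "vector_derivative (\<lambda>s. \<Theta> (x t) s) (at t within {0..}) = D (0, 1)"
    using t at_le[of "{t<..}" "{0..}" t] trivial_limit_at_right_real[of t]
    by (intro vector_derivative_within) (auto simp: bot_unique subset_iff)
  have "((\<lambda>y. ?\<Theta> (y, t)) has_derivative (\<lambda>v. D (v, 0))) (at (x t) within U)"
    by (rule comp) (use x t in \<open>auto intro!: has_derivative_Pair\<close>)
  then have "((\<lambda>y. \<Theta> y t) has_derivative (\<lambda>v. D (v, 0))) (at (x t))"
    using at_within_open[OF x(1)[OF t] \<open>open U\<close>] by simp
  then have space: "frechet_derivative (\<lambda>y. \<Theta> y t) (at (x t)) = (\<lambda>v. D (v, 0))"
    by (rule frechet_derivative_at[symmetric])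
  have "(\<Sum>k\<in>UNIV. v $ k *\<^sub>R D (axis k 1, 0)) = D (v, 0)" for v
  proof -
    have "(\<Sum>k\<in>UNIV. v $ k *\<^sub>R (axis k 1, 0 :: real)) = (v, 0)"
      using basis_expansion[of v] by (simp add: scalar_mult_eq_scaleR prod_eq_iff fst_sum snd_sum)
    then have "D (v, 0) = D (\<Sum>k\<in>UNIV. v $ k *\<^sub>R (axis k 1, 0))" by simp
    then show ?thesis by (simp only: D.sum D.scale)
  qed
  then have "trajectory_derivative f \<Theta> (x t) t = D (0, 1) + D (f (x t) t, 0)"
    by (simp add: trajectory_derivative_def time space)
  also have "\<dots> = D (f (x t) t, 1)" by (simp flip: D.add)
  finally show ?thesis using along by simp
qed

text \<open>
  The generalized Jacobian is the coefficient matrix of the variational equation in the coordinates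
  \<open>\<Theta> \<delta>\<close>: the product rule gives the coefficients \<open>\<Theta> J + \<Theta>'\<close> on \<open>\<delta>\<close>, and inserting
  the inverse of \<open>\<Theta>\<close> expresses them on \<open>\<Theta> \<delta>\<close>.
\<close>
lemma has_vector_derivative_transformed_displacement:
  fixes f :: "real ^ 'n \<Rightarrow> real \<Rightarrow> real ^ 'n"
  assumes C1: "C1_on (\<lambda>(x, t). \<Theta> x t) (U \<times> {0..})" and "open U"
    and inv: "invertible (\<Theta> (x t) t)"
    and sol: "solution_on f U {0..} x" and \<delta>: "displacement f x \<delta>" and t: "t \<ge> 0"
  shows "((\<lambda>s. \<Theta> (x s) s *v cvec (\<delta> s)) has_vector_derivative
    generalized_jacobian f \<Theta> (x t) t *v (\<Theta> (x t) t *v cvec (\<delta> t))) (at t within {0..})"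
proof -
  let ?T = "\<Theta> (x t) t" and ?T' = "trajectory_derivative f \<Theta> (x t) t" and ?J = "state_jacobian f (x t) t"
  have dT: "((\<lambda>s. \<Theta> (x s) s $ r $ k) has_vector_derivative ?T' $ r $ k) (at t within {0..})" for r k
    using has_vector_derivative_along_solution[OF C1 \<open>open U\<close> sol t] by (simp add: has_vector_derivative_vec_iff)
  have d\<delta>: "((\<lambda>s. complex_of_real (\<delta> s $ k)) has_vector_derivative of_real ((?J *v \<delta> t) $ k)) (at t within {0..})" for k
    using \<delta> t
    by (intro has_vector_derivative_of_real)
      (simp add: displacement_def has_real_derivative_iff_has_vector_derivative has_vector_derivative_vec_iff)
  have "((\<lambda>s. (\<Theta> (x s) s *v cvec (\<delta> s)) $ r) has_vector_derivative
      (?T' *v cvec (\<delta> t) + ?T *v cvec (?J *v \<delta> t)) $ r) (at t within {0..})" for r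
  proof -
    have "((\<lambda>s. \<Sum>k\<in>UNIV. \<Theta> (x s) s $ r $ k * of_real (\<delta> s $ k)) has_vector_derivative
        (\<Sum>k\<in>UNIV. ?T $ r $ k * of_real ((?J *v \<delta> t) $ k) + ?T' $ r $ k * of_real (\<delta> t $ k)))
        (at t within {0..})"
      by (intro has_vector_derivative_sum has_vector_derivative_mult dT d\<delta>)
    then show ?thesis
      by (simp add: matrix_vector_mult_def[of "\<Theta> _ _"] matrix_vector_mult_def[of ?T'] cvec_def
          sum.distrib add.commute)
  qed
  then have "((\<lambda>s. \<Theta> (x s) s *v cvec (\<delta> s)) has_vector_derivative
      (?T' *v cvec (\<delta> t) + ?T *v cvec (?J *v \<delta> t))) (at t within {0..})"
    by (simp add: has_vector_derivative_vec_iff)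
  moreover have "cvec (?J *v \<delta> t) = map_matrix complex_of_real ?J *v cvec (\<delta> t)"
    by (simp add: vec_eq_iff cvec_def matrix_vector_mult_def map_matrix_def)
  moreover have "matrix_inv ?T ** ?T = mat 1"
    using inv someI_ex[of "\<lambda>B. ?T ** B = mat 1 \<and> B ** ?T = mat 1"]
    by (simp add: invertible_def matrix_inv_def)
  then have "matrix_inv ?T *v (?T *v w) = w" for w
    by (simp add: matrix_vector_mul_assoc)
  ultimately show ?thesis
    by (simp add: generalized_jacobian_def matrix_vector_mult_add_rdistrib add.commute
        flip: matrix_vector_mul_assoc)
qed

section \<open>Growth of volumes\<close>

text \<open>
  Only the Hermitian part of \<open>F\<close> changes lengths and angles.
\<close>
lemma gram_matrix_variation:
  "cinner (F *v z j) (z l) + cinner (z j) (F *v z l) = 2 * cinner (z j) (hermitian_part F *v z l)"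
proof -
  have "2 * cinner (z j) (hermitian_part F *v z l) = cinner (z j) ((F + conj_transpose F) *v z l)"
    by (simp add: hermitian_part_def cinner_simps scaleR_complex_matrix_vector)
  also have "\<dots> = cinner (F *v z j) (z l) + cinner (z j) (F *v z l)"
    by (simp add: matrix_vector_mult_add_rdistrib cinner_simps cinner_matrix_vector)
  finally show ?thesis by simp
qed

lemma has_vector_derivative_cinner:
  assumes "(u has_vector_derivative u') (at t within S)" "(v has_vector_derivative v') (at t within S)"
  shows "((\<lambda>s. cinner (u s) (v s)) has_vector_derivative cinner u' (v t) + cinner (u t) v') (at t within S)"
proof -
  have "((\<lambda>s. \<Sum>k\<in>UNIV. cnj (u s $ k) * v s $ k) has_vector_derivative
      (\<Sum>k\<in>UNIV. cnj (u t $ k) * v' $ k + cnj (u' $ k) * v t $ k)) (at t within S)"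
    using assms unfolding has_vector_derivative_vec_iff
    by (intro has_vector_derivative_sum has_vector_derivative_mult has_vector_derivative_cnj) auto
  then show ?thesis by (simp add: cinner_def sum.distrib add.commute)
qed

lemma gram_determinant_derivative_le:
  fixes z :: "'i::finite \<Rightarrow> real \<Rightarrow> complex ^ 'n"
  assumes "\<And>j. (z j has_vector_derivative F *v z j t) (at t within S)"
  shows "\<exists>g'. ((\<lambda>s. Re (det (gram_matrix (\<lambda>j. z j s)))) has_real_derivative g') (at t within S) \<and>
    g' \<le> 2 * (\<Sum>k=1..CARD('i). ranked_eigenvalue (hermitian_part F) k) * Re (det (gram_matrix (\<lambda>j. z j t)))"
proof -
  let ?M' = "\<chi> j l. 2 * cinner (z j t) (hermitian_part F *v z l t)"
  have "((\<lambda>s. gram_matrix (\<lambda>j. z j s) $ j $ l) has_vector_derivative ?M' $ j $ l) (at t within S)" for j l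
    using has_vector_derivative_cinner[OF assms assms, of j l]
    by (simp add: gram_matrix_def gram_matrix_variation[of F "\<lambda>j. z j t"])
  then have "((\<lambda>s. det (gram_matrix (\<lambda>j. z j s))) has_vector_derivative
      det_variation (gram_matrix (\<lambda>j. z j t)) ?M') (at t within S)"
    by (rule has_vector_derivative_det)
  then have "((\<lambda>s. Re (det (gram_matrix (\<lambda>j. z j s)))) has_real_derivative
      Re (det_variation (gram_matrix (\<lambda>j. z j t)) ?M')) (at t within S)"
    by (simp add: has_vector_derivative_complex_iff)
  moreover note det_variation_gram_le[of "hermitian_part F" "\<lambda>j. z j t"]
  ultimately show ?thesis by auto
qed

text \<open>
  Gronwall's argument with an integrating factor; the term \<open>\<gamma>'\<close> is absorbed by the factor
  \<open>exp (2 * \<gamma>)\<close> and contributes only the boundary values of \<open>\<gamma>\<close>. The factors 2 are those of a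
  squared volume.
\<close>
lemma exponential_decay_of_weighted_bound:
  fixes g \<gamma> :: "real \<Rightarrow> real"
  assumes g: "\<And>t. t \<ge> 0 \<Longrightarrow> (g has_real_derivative g' t) (at t within {0..})"
    and \<gamma>: "\<And>t. t \<ge> 0 \<Longrightarrow> (\<gamma> has_real_derivative \<gamma>' t) (at t within {0..})"
    and le: "\<And>t. t \<ge> 0 \<Longrightarrow> g' t \<le> - 2 * (\<alpha> + \<gamma>' t) * g t"
    and t: "t \<ge> 0"
  shows "g t \<le> exp (2 * (\<gamma> 0 - \<gamma> t) - 2 * \<alpha> * t) * g 0"
proof -
  define h where "h s = g s * exp (2 * \<alpha> * s + 2 * \<gamma> s)" for s
  have h: "(h has_real_derivative (g' s + 2 * (\<alpha> + \<gamma>' s) * g s) * exp (2 * \<alpha> * s + 2 * \<gamma> s)) (at s within {0..})"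
    if "s \<ge> 0" for s
    unfolding h_def
    by (rule derivative_eq_intros g[OF that] \<gamma>[OF that] refl)+ (simp add: algebra_simps)
  have "h t \<le> h 0"
  proof (rule DERIV_nonpos_imp_decreasing_open[OF t])
    fix s assume s: "0 < s" "s < t"
    have "at s within {0..} = at s"
      using s by (intro at_within_interior) simp
    moreover have "(g' s + 2 * (\<alpha> + \<gamma>' s) * g s) * exp (2 * \<alpha> * s + 2 * \<gamma> s) \<le> 0"
      using le[of s] s by (intro mult_nonpos_nonneg) (auto simp: algebra_simps)
    ultimately show "\<exists>y. (h has_real_derivative y) (at s) \<and> y \<le> 0"
      using h[of s] s by auto
  next
    have "continuous_on {0..} h"
      using h by (auto intro!: DERIV_continuous_on)
    then show "continuous_on {0..t} h" by (rule continuous_on_subset) auto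
  qed
  then have "g t * exp (2 * \<alpha> * t + 2 * \<gamma> t) \<le> g 0 * exp (2 * \<gamma> 0)"
    by (simp add: h_def)
  then have "g t * exp (2 * \<alpha> * t + 2 * \<gamma> t) * exp (- (2 * \<alpha> * t + 2 * \<gamma> t)) \<le>
      g 0 * exp (2 * \<gamma> 0) * exp (- (2 * \<alpha> * t + 2 * \<gamma> t))"
    by (rule mult_right_mono) simp
  then show ?thesis
    by (simp add: mult.assoc algebra_simps flip: exp_add)
qed

theorem theorem4:
  fixes f :: "real ^ 'n \<Rightarrow> real \<Rightarrow> real ^ 'n"
    and U X :: "(real ^ 'n) set"
    and \<Theta> :: "real ^ 'n \<Rightarrow> real \<Rightarrow> complex ^ 'n ^ 'n"
    and \<gamma> \<gamma>' :: "real \<Rightarrow> real"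
    and \<alpha> :: real
  assumes "CARD('i::finite) \<le> CARD('n)"
    and "open U" and "X \<subseteq> U"
    and "C1_on (\<lambda>(x, t). f x t) (U \<times> {0..})"
    and "forward_invariant f U X"
    and "solutions_exist f U X"
    and "metric_transformation U X \<Theta>"
    and "\<And>t. t \<ge> 0 \<Longrightarrow> (\<gamma> has_real_derivative \<gamma>' t) (at t within {0..})"
    and "bounded (\<gamma> ` {0..})"
    and "\<alpha> > 0"
    and "\<And>x t. x \<in> X \<Longrightarrow> t \<ge> 0 \<Longrightarrow>
           (\<Sum>k=1..CARD('i). ranked_eigenvalue (hermitian_part (generalized_jacobian f \<Theta> x t)) k)
             + \<gamma>' t \<le> - \<alpha>"
  shows "\<exists>C>0. \<forall>x. solution_on f U {0..} x \<and> (\<forall>t\<ge>0. x t \<in> X) \<longrightarrow>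
           (\<forall>\<delta> :: 'i \<Rightarrow> real \<Rightarrow> real ^ 'n. (\<forall>j. displacement f x (\<delta> j)) \<longrightarrow>
             (\<forall>t\<ge>0. wedge_norm (\<lambda>j. \<Theta> (x t) t *v cvec (\<delta> j t))
                \<le> C * exp (- \<alpha> * t) * wedge_norm (\<lambda>j. \<Theta> (x 0) 0 *v cvec (\<delta> j 0))))"
proof -
  have C1: "C1_on (\<lambda>(x, t). \<Theta> x t) (U \<times> {0..})"
    and inv: "\<And>x t. x \<in> X \<Longrightarrow> t \<ge> 0 \<Longrightarrow> invertible (\<Theta> x t)"
    using \<open>metric_transformation U X \<Theta>\<close> by (auto simp: metric_transformation_def)
  obtain b where b: "\<And>t. t \<ge> 0 \<Longrightarrow> \<bar>\<gamma> t\<bar> \<le> b"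
    using \<open>bounded (\<gamma> ` {0..})\<close> by (auto simp: bounded_iff)
  \<comment> \<open>\<open>2 * b\<close> bounds the difference \<open>\<gamma> 0 - \<gamma> t\<close> left over by the integrating factor\<close>
  show ?thesis
  proof (intro exI[of _ "exp (2 * b)"] conjI allI impI)
    fix x :: "real \<Rightarrow> real ^ 'n" and \<delta> :: "'i \<Rightarrow> real \<Rightarrow> real ^ 'n" and t :: real
    assume "solution_on f U {0..} x \<and> (\<forall>t\<ge>0. x t \<in> X)" and \<delta>: "\<forall>j. displacement f x (\<delta> j)"
      and t: "t \<ge> 0"
    then have sol: "solution_on f U {0..} x" and X: "\<And>t. t \<ge> 0 \<Longrightarrow> x t \<in> X" by auto
    define z where "z j s = \<Theta> (x s) s *v cvec (\<delta> j s)" for j s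
    define g where "g s = Re (det (gram_matrix (\<lambda>j. z j s)))" for s
    define \<Lambda> where "\<Lambda> s = (\<Sum>k=1..CARD('i).
      ranked_eigenvalue (hermitian_part (generalized_jacobian f \<Theta> (x s) s)) k)" for s
    have nonneg: "g s \<ge> 0" for s by (simp add: g_def Re_det_gram_matrix_nonneg)
    have "(z j has_vector_derivative generalized_jacobian f \<Theta> (x s) s *v z j s) (at s within {0..})"
      if "s \<ge> 0" for j s
      unfolding z_def using that \<delta>
      by (intro has_vector_derivative_transformed_displacement[OF C1 \<open>open U\<close> inv[OF X] sol]) auto
    from gram_determinant_derivative_le[of z, OF this]
    have "\<exists>d. (g has_real_derivative d) (at s within {0..}) \<and> d \<le> 2 * \<Lambda> s * g s" if "s \<ge> 0" for s
      using that unfolding g_def \<Lambda>_def by blast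
    then obtain g' where g': "\<And>s. s \<ge> 0 \<Longrightarrow> (g has_real_derivative g' s) (at s within {0..})"
      "\<And>s. s \<ge> 0 \<Longrightarrow> g' s \<le> 2 * \<Lambda> s * g s" by metis
    have "g' s \<le> - 2 * (\<alpha> + \<gamma>' s) * g s" if s: "s \<ge> 0" for s
    proof -
      have "\<Lambda> s \<le> - (\<alpha> + \<gamma>' s)"
        using assms(11)[OF X[OF s] s] by (simp add: \<Lambda>_def)
      then have "2 * \<Lambda> s * g s \<le> 2 * (- (\<alpha> + \<gamma>' s)) * g s"
        by (intro mult_right_mono nonneg) simp
      then show ?thesis using g'(2)[OF s] by simp
    qed
    then have "g t \<le> exp (2 * (\<gamma> 0 - \<gamma> t) - 2 * \<alpha> * t) * g 0"
      using exponential_decay_of_weighted_bound[OF g'(1) assms(8) _ t] by blast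
    also have "exp (2 * (\<gamma> 0 - \<gamma> t) - 2 * \<alpha> * t) \<le> exp (2 * (2 * b) - 2 * \<alpha> * t)"
      using b[of 0] b[OF t] by simp
    also have "\<dots> = (exp (2 * b) * exp (- \<alpha> * t))\<^sup>2"
      by (simp add: power2_eq_square algebra_simps flip: exp_add)
    finally have "g t \<le> (exp (2 * b) * exp (- \<alpha> * t))\<^sup>2 * g 0"
      using nonneg[of 0] by (simp add: mult_right_mono)
    then have "sqrt (g t) \<le> sqrt ((exp (2 * b) * exp (- \<alpha> * t))\<^sup>2 * g 0)"
      by (rule real_sqrt_le_mono)
    also have "\<dots> = exp (2 * b) * exp (- \<alpha> * t) * sqrt (g 0)"
      by (simp add: real_sqrt_mult)
    finally show "wedge_norm (\<lambda>j. \<Theta> (x t) t *v cvec (\<delta> j t))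
        \<le> exp (2 * b) * exp (- \<alpha> * t) * wedge_norm (\<lambda>j. \<Theta> (x 0) 0 *v cvec (\<delta> j 0))"
      by (simp add: wedge_norm_def g_def z_def)
  qed simp
qed

end
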